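(* For every $C>0$ there exists $c>0$ such that the following holds. If $d\geq 2$ is an integer and $D$ is a finite $(C,d)$-regular digraph with girth $g$, then $D$ contains a directed path of length at least $\frac{c\,d\,g}{\log d}$.
   Context: A digraph $D$ is $(C,d)$-regular if $d^+(v)\geq d$ and $d^-(v)\leq Cd$ for every vertex $v$ (out-degree and in-degree respectively). The girth is the minimum length of a directed cycle. Path length counts arcs. *)

theory Defs
  imports Complex_Main "HOL-Library.Extended_Nat" "Graph_Theory.Arc_Walk"
begin

definition Cd_regular :: "real \<Rightarrow> nat \<Rightarrow> ('a, 'b) pre_digraph \<Rightarrow> bool" where
  "Cd_regular C d D \<longleftrightarrow>
     (\<forall>v \<in> verts D. d \<le> out_degree D v \<and> real (in_degree D v) \<le> C * real d)"

text \<open>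
  Directed cycles of length 2 count. The girth of an acyclic digraph is \<open>\<infinity>\<close>.
\<close>
definition girth :: "('a, 'b) pre_digraph \<Rightarrow> enat" where
  "girth D = (INF p \<in> {p. pre_digraph.cycle D p}. enat (length p))"

end

theory Submission
  imports Defs "HOL-Library.FuncSet"
begin

text \<open>
  Colour the vertices at random with about \<open>d / log d\<close> colours. By the local lemma some colouring
  gives every vertex an out-neighbour of every colour, because the bad event at a vertex has
  probability at most a negative power of \<open>d\<close> and meets only \<open>O(d\<^sup>2)\<close> other bad events (here
  the in-degree bound enters). A maximal path inside one colour class has at least \<open>g\<close>
  vertices, since an out-neighbour of its end in that class closes a cycle. From its end one can step
  into the next colour class, and so all classes are traversed one after the other.
\<close>

section \<open>The local lemma, by counting\<close>

text \<open>Symmetric local lemma for the uniform measure on \<open>\<Omega>\<close>, with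
  probabilities written as ratios of cardinalities. Independence enters only as an upper bound on
  the conditional probability of \<open>A i\<close> given that all events of \<open>S\<close> fail.
  As \<open>N i\<close> contains \<open>i\<close>, the number \<open>D\<close> counts
  \<open>i\<close> itself.\<close>

lemma lovasz_local_counting:
  fixes A :: "'i \<Rightarrow> 'w set" and p D :: real
  assumes fin: "finite I" "finite \<Omega>" "\<Omega> \<noteq> {}" and p: "0 \<le> p" "4 * p * D \<le> 1"
    and N: "\<And>i. i \<in> I \<Longrightarrow> i \<in> N i" "\<And>i. i \<in> I \<Longrightarrow> real (card (N i \<inter> I)) \<le> D"
    and indep: "\<And>i S. i \<in> I \<Longrightarrow> S \<subseteq> I - N i \<Longrightarrow>
       real (card (A i \<inter> (\<Omega> - \<Union>(A ` S)))) \<le> p * real (card (\<Omega> - \<Union>(A ` S)))"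
  shows "\<Omega> - \<Union>(A ` I) \<noteq> {}"
proof -
  define good where "good S = \<Omega> - \<Union>(A ` S)" for S
  have fg [simp]: "finite (good S)" for S using fin by (simp add: good_def)
  \<comment> \<open>Conditioned on avoiding \<open>S\<close>, the event \<open>A i\<close> has
    probability at most \<open>2 * p\<close>. Induction is on the size of \<open>S\<close>, for all
    \<open>i\<close> at once.\<close>
  have cond: "real (card (A i \<inter> good S)) \<le> 2 * p * real (card (good S))"
    if "i \<in> I" "S \<subseteq> I" for i S
    using that
  proof (induction "card S" arbitrary: S i rule: less_induct)
    case less
    have finS: "finite S" using less.prems fin finite_subset by blast
    define R where "R = S - N i"
    have R: "real (card (A i \<inter> good R)) \<le> p * real (card (good R))"
      unfolding good_def by (rule indep) (use less.prems in \<open>auto simp: R_def\<close>)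
    show ?case
    proof (cases "S \<inter> N i = {}")
      case True
      then have "R = S" by (auto simp: R_def)
      then show ?thesis using R mult_nonneg_nonneg[OF p(1), of "real (card (good S))"] by simp
    next
      case False
      then have "card R < card S" by (intro psubset_card_mono finS) (auto simp: R_def)
      then have IH: "real (card (A j \<inter> good R)) \<le> 2 * p * real (card (good R))" if "j \<in> S" for j
        using less.hyps[of R j] less.prems that by (auto simp: R_def)
      \<comment> \<open>A point of \<open>good R\<close> missing from \<open>good S\<close> lies in
        some \<open>A j\<close> with \<open>j\<close> in \<open>S \<inter> N i\<close>. By induction
        each such event takes at most a fraction \<open>2 * p\<close> of \<open>good R\<close>, and
        there are at most \<open>D\<close> of them, so at least half of \<open>good R\<close>
        survives. This is the source of the factor 2.\<close>
      have "good R \<subseteq> good S \<union> (\<Union>j\<in>S \<inter> N i. A j \<inter> good R)"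
        by (auto simp: good_def R_def)
      then have "card (good R) \<le> card (good S \<union> (\<Union>j\<in>S \<inter> N i. A j \<inter> good R))"
        using finS by (intro card_mono) auto
      also have "\<dots> \<le> card (good S) + card (\<Union>j\<in>S \<inter> N i. A j \<inter> good R)"
        by (rule card_Un_le)
      also have "\<dots> \<le> card (good S) + (\<Sum>j\<in>S \<inter> N i. card (A j \<inter> good R))"
        using finS by (intro add_left_mono card_UN_le) auto
      finally have "real (card (good R)) \<le> card (good S) + (\<Sum>j\<in>S \<inter> N i. real (card (A j \<inter> good R)))"
        by (simp flip: of_nat_sum of_nat_add)
      also have "(\<Sum>j\<in>S \<inter> N i. real (card (A j \<inter> good R)))
          \<le> real (card (S \<inter> N i)) * (2 * p * real (card (good R)))"
        using sum_bounded_above[of "S \<inter> N i" "\<lambda>j. real (card (A j \<inter> good R))"] IH by auto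
      also have "\<dots> \<le> D * (2 * p * real (card (good R)))"
      proof (rule mult_right_mono)
        have "card (S \<inter> N i) \<le> card (N i \<inter> I)"
          using less.prems fin by (intro card_mono) auto
        then show "real (card (S \<inter> N i)) \<le> D" using N(2)[OF less.prems(1)] by linarith
      qed (use p in auto)
      also have "\<dots> \<le> real (card (good R)) / 2"
        using mult_right_mono[OF p(2), of "real (card (good R))"] by (simp add: mult_ac)
      finally have half: "real (card (good R)) \<le> 2 * real (card (good S))" by simp
      have "card (A i \<inter> good S) \<le> card (A i \<inter> good R)"
        using fin by (intro card_mono) (auto simp: good_def R_def)
      then have "real (card (A i \<inter> good S)) \<le> p * real (card (good R))" using R by linarith
      also have "\<dots> \<le> p * (2 * real (card (good S)))" using half p by (intro mult_left_mono)
      finally show ?thesis by simp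
    qed
  qed
  have "good S \<noteq> {}" if "S \<subseteq> I" for S
    using finite_subset[OF that fin(1)] that
  proof (induction S rule: finite_induct)
    case empty
    then show ?case using fin by (simp add: good_def)
  next
    case (insert i S)
    \<comment> \<open>Since \<open>i\<close> lies in \<open>N i\<close>, \<open>D\<close> is at
      least 1 and \<open>p\<close> at most 1/4. So \<open>2 * p < 1\<close>, and one more event
      cannot cover \<open>good S\<close>.\<close>
    have "card {i} \<le> card (N i \<inter> I)"
      using insert.prems fin N(1) by (intro card_mono) auto
    then have "1 \<le> D" using N(2)[of i] insert.prems by simp
    then have "4 * p \<le> 4 * p * D" using p(1) by (simp add: mult_le_cancel_left1)
    then have p4: "p \<le> 1 / 4" using p(2) by linarith
    have pos: "0 < real (card (good S))" using insert by (simp add: card_gt_0_iff)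
    have "real (card (A i \<inter> good S)) \<le> 2 * p * real (card (good S))"
      using cond insert.prems by blast
    also have "\<dots> \<le> (1 / 2) * real (card (good S))"
      using p4 by (intro mult_right_mono) auto
    also have "\<dots> < real (card (good S))" using pos by simp
    finally have "\<not> good S \<subseteq> A i" by (auto simp: Int_absorb1)
    then show ?case by (auto simp: good_def)
  qed
  then show ?thesis by (auto simp: good_def)
qed

section \<open>Random colourings\<close>

text \<open>Independence is witnessed by exchanging the values on \<open>N\<close> of two functions.\<close>
lemma card_Int_mult_card_PiE_le:
  assumes V: "finite V" "\<And>x. x \<in> V \<Longrightarrow> finite (B x)"
    and A: "A \<subseteq> PiE V B" and G: "G \<subseteq> PiE V B"
    and depA: "\<And>f h. f \<in> A \<Longrightarrow> h \<in> PiE V B \<Longrightarrow> (\<And>x. x \<in> N \<Longrightarrow> f x = h x) \<Longrightarrow> h \<in> A"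
    and depG: "\<And>f h. f \<in> G \<Longrightarrow> h \<in> PiE V B \<Longrightarrow> (\<And>x. x \<notin> N \<Longrightarrow> f x = h x) \<Longrightarrow> h \<in> G"
  shows "card (A \<inter> G) * card (PiE V B) \<le> card A * card G"
proof -
  define mix where "mix f h = (\<lambda>x. if x \<in> N then f x else h x)" for f h :: "'a \<Rightarrow> 'b"
  have finP: "finite (PiE V B)" using V by (intro finite_PiE) auto
  have mixP: "mix f h \<in> PiE V B" if "f \<in> PiE V B" "h \<in> PiE V B" for f h
    using that by (auto simp: mix_def PiE_iff extensional_def)
  have "mix (mix f h) (mix h f) = f" for f h by (auto simp: mix_def)
  then have inj: "inj_on (\<lambda>(f, h). (mix f h, mix h f)) ((A \<inter> G) \<times> PiE V B)"
    by (intro inj_on_inverseI[where g = "\<lambda>(f, h). (mix f h, mix h f)"]) (simp split: prod.split)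
  \<comment> \<open>\<open>mix f h\<close> agrees with \<open>f\<close> on \<open>N\<close>, which
    decides membership in \<open>A\<close>; \<open>mix h f\<close> agrees with \<open>f\<close> off
    \<open>N\<close>, which decides membership in \<open>G\<close>. The second function
    \<open>h\<close> is arbitrary.\<close>
  have "(\<lambda>(f, h). (mix f h, mix h f)) ` ((A \<inter> G) \<times> PiE V B) \<subseteq> A \<times> G"
  proof clarsimp
    fix f h assume f: "f \<in> A" "f \<in> G" and h: "h \<in> PiE V B"
    have fP: "f \<in> PiE V B" using f A by blast
    have "mix f h \<in> A"
      by (rule depA[OF f(1) mixP[OF fP h]]) (simp add: mix_def)
    moreover have "mix h f \<in> G"
      by (rule depG[OF f(2) mixP[OF h fP]]) (simp add: mix_def)
    ultimately show "mix f h \<in> A \<and> mix h f \<in> G" ..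
  qed
  then have "card ((A \<inter> G) \<times> PiE V B) \<le> card (A \<times> G)"
    by (rule card_inj_on_le[OF inj])
      (use A G finP finite_subset in \<open>blast intro: finite_cartesian_product\<close>)
  then show ?thesis by (simp add: card_cartesian_product)
qed

text \<open>The colourings in question form a product set, with one colour removed at each vertex of
  \<open>N\<close>. Each such vertex contributes a factor 1 - 1/k, which is at most
  exp(-1/k).\<close>

lemma card_colourings_avoiding:
  fixes V :: "'a set"
  assumes "finite V" "N \<subseteq> V" "i < k"
  shows "real (card {f \<in> V \<rightarrow>\<^sub>E {..<k}. \<forall>u\<in>N. f u \<noteq> i})
    \<le> exp (- real (card N) / real k) * real (card (V \<rightarrow>\<^sub>E {..<k}))"
proof -
  have k: "0 < k" using assms by simp
  have fN: "finite N" using assms finite_subset by blast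
  have "{f \<in> V \<rightarrow>\<^sub>E {..<k}. \<forall>u\<in>N. f u \<noteq> i}
      = PiE V (\<lambda>u. if u \<in> N then {..<k} - {i} else {..<k})"
    using assms(2) by (auto simp: PiE_iff extensional_def split: if_splits)
  then have "card {f \<in> V \<rightarrow>\<^sub>E {..<k}. \<forall>u\<in>N. f u \<noteq> i}
      = (\<Prod>u\<in>V. if u \<in> N then k - 1 else k)"
    using assms by (auto simp: card_PiE intro!: prod.cong)
  also have "\<dots> = (k - 1) ^ card N * k ^ card (V - N)"
    using assms by (simp add: prod.If_cases Int_absorb1 Diff_eq)
  finally have "real (card {f \<in> V \<rightarrow>\<^sub>E {..<k}. \<forall>u\<in>N. f u \<noteq> i})
      = (real k - 1) ^ card N * real k ^ card (V - N)"
    using k by (simp add: of_nat_diff)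
  also have "\<dots> \<le> (exp (- 1 / real k) * real k) ^ card N * real k ^ card (V - N)"
  proof (intro mult_right_mono power_mono)
    have "real k - 1 = (1 + - 1 / real k) * real k" using k by (simp add: field_simps)
    also have "\<dots> \<le> exp (- 1 / real k) * real k"
      by (intro mult_right_mono exp_ge_add_one_self) simp
    finally show "real k - 1 \<le> exp (- 1 / real k) * real k" .
  qed (use k in auto)
  also have "\<dots> = exp (- real (card N) / real k) * real k ^ (card N + card (V - N))"
    by (simp add: power_mult_distrib power_add exp_of_nat_mult[symmetric] mult_ac)
  also have "card N + card (V - N) = card V"
    using assms fN by (metis card_Diff_subset card_mono le_add_diff_inverse)
  also have "real k ^ card V = real (card (V \<rightarrow>\<^sub>E {..<k}))"
    using assms by (simp add: card_PiE)
  finally show ?thesis .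
qed

text \<open>The bad event \<open>A v\<close> says that some colour is missing on \<open>N v\<close>;
  a union bound over the colours gives its probability bound \<open>p\<close>. Two events interact
  only if their sets meet, and each of the \<open>d\<close> elements of \<open>N v\<close> lies in
  at most \<open>\<Delta>\<close> sets, so \<open>d * \<Delta>\<close> bounds the neighbourhood
  size.\<close>

lemma exists_rainbow_colouring:
  fixes N :: "'a \<Rightarrow> 'a set" and \<Delta> :: real
  assumes V: "finite V" and N: "\<And>v. v \<in> V \<Longrightarrow> N v \<subseteq> V" "\<And>v. v \<in> V \<Longrightarrow> card (N v) = d"
    and \<Delta>: "\<And>u. u \<in> V \<Longrightarrow> real (card {v \<in> V. u \<in> N v}) \<le> \<Delta>"
    and d: "0 < d" and k: "0 < k"
    and small: "4 * (real k * exp (- real d / real k)) * (real d * \<Delta>) \<le> 1"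
  shows "\<exists>f. (\<forall>v\<in>V. f v < k) \<and> (\<forall>v\<in>V. \<forall>i<k. \<exists>u\<in>N v. f u = i)"
proof -
  let ?\<Omega> = "V \<rightarrow>\<^sub>E {..<k}"
  define p where "p = real k * exp (- real d / real k)"
  define A where "A v = {f \<in> ?\<Omega>. \<exists>i<k. \<forall>u\<in>N v. f u \<noteq> i}" for v
  define Nb where "Nb v = {w. N w \<inter> N v \<noteq> {}}" for v
  have fin\<Omega>: "finite ?\<Omega>" using V by (intro finite_PiE) auto
  have ne: "?\<Omega> \<noteq> {}" using k by (auto simp: PiE_eq_empty_iff)
  have cardA: "real (card (A v)) \<le> p * real (card ?\<Omega>)" if "v \<in> V" for v
  proof -
    have "A v = (\<Union>i\<in>{..<k}. {f \<in> ?\<Omega>. \<forall>u\<in>N v. f u \<noteq> i})" by (auto simp: A_def)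
    then have "card (A v) \<le> (\<Sum>i<k. card {f \<in> ?\<Omega>. \<forall>u\<in>N v. f u \<noteq> i})"
      using card_UN_le[of "{..<k}" "\<lambda>i. {f \<in> ?\<Omega>. \<forall>u\<in>N v. f u \<noteq> i}"] by simp
    then have "real (card (A v)) \<le> (\<Sum>i<k. real (card {f \<in> ?\<Omega>. \<forall>u\<in>N v. f u \<noteq> i}))"
      by (simp flip: of_nat_sum)
    also have "\<dots> \<le> (\<Sum>i<k. exp (- real d / real k) * real (card ?\<Omega>))"
    proof (rule sum_mono)
      fix i assume "i \<in> {..<k}"
      then show "real (card {f \<in> ?\<Omega>. \<forall>u\<in>N v. f u \<noteq> i})
          \<le> exp (- real d / real k) * real (card ?\<Omega>)"
        using card_colourings_avoiding[OF V N(1)[OF that], of i k] N(2)[OF that] by simp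
    qed
    finally show ?thesis by (simp add: p_def)
  qed
  have "?\<Omega> - \<Union>(A ` V) \<noteq> {}"
  proof (rule lovasz_local_counting[where p = p and D = "real d * \<Delta>" and N = Nb])
    show "4 * p * (real d * \<Delta>) \<le> 1" using small by (simp add: p_def)
    show "v \<in> Nb v" if "v \<in> V" for v using N(2)[OF that] d by (auto simp: Nb_def)
    show "real (card (Nb v \<inter> V)) \<le> real d * \<Delta>" if v: "v \<in> V" for v
    proof -
      have fN: "finite (N v)" using N(1)[OF v] V finite_subset by blast
      have "Nb v \<inter> V = (\<Union>u\<in>N v. {w \<in> V. u \<in> N w})" by (auto simp: Nb_def)
      then have "card (Nb v \<inter> V) \<le> (\<Sum>u\<in>N v. card {w \<in> V. u \<in> N w})"
        using card_UN_le[OF fN, of "\<lambda>u. {w \<in> V. u \<in> N w}"] by simp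
      then have "real (card (Nb v \<inter> V)) \<le> (\<Sum>u\<in>N v. real (card {w \<in> V. u \<in> N w}))"
        by (simp flip: of_nat_sum)
      also have "\<dots> \<le> (\<Sum>u\<in>N v. \<Delta>)" using \<Delta> N(1)[OF v] by (intro sum_mono) auto
      finally show ?thesis using N(2)[OF v] by simp
    qed
    show "real (card (A v \<inter> (?\<Omega> - \<Union>(A ` S)))) \<le> p * real (card (?\<Omega> - \<Union>(A ` S)))"
      if v: "v \<in> V" and S: "S \<subseteq> V - Nb v" for v S
    proof -
      let ?G = "?\<Omega> - \<Union>(A ` S)"
      \<comment> \<open>\<open>A v\<close> is decided by the values on \<open>N v\<close>, and the
        events of \<open>S\<close> by values off \<open>N v\<close>, so the exchange argument
        applies.\<close>
      have "card (A v \<inter> ?G) * card ?\<Omega> \<le> card (A v) * card ?G"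
      proof (rule card_Int_mult_card_PiE_le[where N = "N v"])
        fix f h assume "f \<in> A v" "h \<in> ?\<Omega>" "\<And>x. x \<in> N v \<Longrightarrow> f x = h x"
        then show "h \<in> A v" unfolding A_def by simp
      next
        fix f h assume f: "f \<in> ?G" and h: "h \<in> ?\<Omega>" and eq: "\<And>x. x \<notin> N v \<Longrightarrow> f x = h x"
        have "h \<notin> A w" if w: "w \<in> S" for w
        proof
          assume "h \<in> A w"
          moreover have "f u = h u" if "u \<in> N w" for u
            using that w S eq by (auto simp: Nb_def)
          ultimately have "f \<in> A w" using f by (auto simp: A_def)
          then show False using f w by auto
        qed
        then show "h \<in> ?G" using h by auto
      qed (use V in \<open>auto simp: A_def\<close>)
      then have "real (card (A v \<inter> ?G)) * real (card ?\<Omega>) \<le> real (card (A v)) * real (card ?G)"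
        by (simp flip: of_nat_mult)
      also have "\<dots> \<le> p * real (card ?\<Omega>) * real (card ?G)"
        using cardA[OF v] by (intro mult_right_mono) auto
      finally have "real (card (A v \<inter> ?G)) * real (card ?\<Omega>) \<le> p * real (card ?G) * real (card ?\<Omega>)"
        by (simp add: mult_ac)
      then show ?thesis using ne fin\<Omega> by (simp add: card_gt_0_iff)
    qed
  qed (use V fin\<Omega> ne in \<open>auto simp: p_def\<close>)
  then obtain f where f: "f \<in> ?\<Omega>" "\<And>v. v \<in> V \<Longrightarrow> f \<notin> A v" by auto
  then have "\<forall>v\<in>V. \<forall>i<k. \<exists>u\<in>N v. f u = i" by (auto simp: A_def)
  moreover have "\<forall>v\<in>V. f v < k" using f(1) by (auto simp: PiE_iff)
  ultimately show ?thesis by blast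
qed

section \<open>Paths through the colour classes\<close>

lemma length_ge_girth:
  assumes "pre_digraph.cycle D p" "girth D = enat g"
  shows "g \<le> length p"
proof -
  have "girth D \<le> enat (length p)" unfolding girth_def using assms(1) by (intro INF_lower) auto
  then show ?thesis using assms(2) by simp
qed

text \<open>Needed at the end to pass from counting vertices to counting arcs at the cost of a
  constant factor.\<close>

lemma (in loopfree_digraph) girth_ge_2:
  assumes "girth G = enat g"
  shows "2 \<le> g"
proof -
  have "enat 2 \<le> girth G" unfolding girth_def
    by (intro INF_greatest) (auto simp: cycle_digraph_conv)
  then show ?thesis using assms by simp
qed

lemma (in fin_digraph) apath_length_less:
  assumes "apath u p v"
  shows "length p < card (verts G)"
proof -
  have "Suc (length p) = card (set (awalk_verts u p))"
    using assms by (simp add: apath_def distinct_card length_awalk_verts)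
  also have "\<dots> \<le> card (verts G)"
    using assms by (intro card_mono) (auto simp: apath_def)
  finally show ?thesis by simp
qed

text \<open>A longest path from \<open>w\<close> inside \<open>U\<close> has an arc from its end
  back to itself, closing a cycle. \<open>Suc (length q)\<close> is the number of vertices of the
  path.\<close>

lemma (in fin_digraph) long_apath_in_closed_set:
  assumes g: "girth G = enat g" and w: "w \<in> verts G" "w \<in> U"
    and out: "\<And>x. x \<in> verts G \<Longrightarrow> x \<in> U \<Longrightarrow> \<exists>e\<in>arcs G. tail G e = x \<and> head G e \<in> U"
  shows "\<exists>q x. apath w q x \<and> set (awalk_verts w q) \<subseteq> U \<and> g \<le> Suc (length q)"
proof -
  define P where "P q \<longleftrightarrow> (\<exists>x. apath w q x) \<and> set (awalk_verts w q) \<subseteq> U" for q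
  have "P []" using w by (auto simp: P_def apath_Nil_iff)
  moreover have "\<forall>q. P q \<longrightarrow> length q < card (verts G)"
    using apath_length_less by (auto simp: P_def)
  ultimately obtain q where q: "P q" and max: "\<And>q'. P q' \<Longrightarrow> length q' \<le> length q"
    using ex_has_greatest_nat[of P "[]" length "card (verts G)"] by blast
  obtain x where x: "apath w q x" and qU: "set (awalk_verts w q) \<subseteq> U"
    using q by (auto simp: P_def)
  have aw: "awalk w q x" using x by (simp add: apath_def)
  have xl: "awlast w q = x" using aw by (rule awlast_of_awalk) simp
  have "x \<in> set (awalk_verts w q)" using xl last_in_set[OF awalk_verts_non_Nil] by metis
  then obtain e where e: "e \<in> arcs G" "tail G e = x" "head G e \<in> U"
    using out[of x] qU awalk_last_in_verts[OF aw] by blast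
  have "awalk x [e] (head G e)" using arc_implies_awalk e by blast
  then have aw': "awalk w (q @ [e]) (head G e)" using aw awalk_appendI by blast
  then have vs: "awalk_verts w (q @ [e]) = awalk_verts w q @ [head G e]"
    using awalk_verts_append[OF aw'] by simp
  have "head G e \<in> set (awalk_verts w q)"
  proof (rule ccontr)
    assume "head G e \<notin> set (awalk_verts w q)"
    then have "P (q @ [e])" unfolding P_def using aw' vs x qU e by (auto simp: apath_def)
    then show False using max[of "q @ [e]"] by simp
  qed
  \<comment> \<open>The path is cut at the vertex to which \<open>e\<close> returns; the final piece
    \<open>s\<close> together with \<open>e\<close> is the cycle.\<close>
  then obtain r s where rs: "q = r @ s" "awalk w r (head G e)" "awalk (head G e) s x"
    using awalk_decomp[OF aw] by blast
  have s: "apath (head G e) s x"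
    using x rs by (auto simp: apath_append_iff)
  have aws: "awalk (head G e) (s @ [e]) (head G e)"
    using rs(3) \<open>awalk x [e] (head G e)\<close> awalk_appendI by blast
  have "awlast (head G e) s = x" using rs(3) by (rule awlast_of_awalk) simp
  then have vss: "awalk_verts (head G e) (s @ [e]) = awalk_verts (head G e) s @ [head G e]"
    using awalk_verts_append[OF aws] by simp
  have hd_s: "hd (awalk_verts (head G e) s) = head G e" using rs(3) by simp
  \<comment> \<open>The base vertex \<open>head G e\<close> is listed first and last;
    \<open>tl\<close> drops the first copy.\<close>
  have "distinct (tl (awalk_verts (head G e) (s @ [e])))"
    using s hd_s unfolding vss apath_def
    by (cases "awalk_verts (head G e) s") auto
  then have "cycle (s @ [e])" using aws by (auto simp: cycle_def)
  then have "g \<le> Suc (length s)" using length_ge_girth[OF _ g] by fastforce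
  then show ?thesis using x qU rs(1) by (intro exI[of _ q] exI[of _ x]) auto
qed

lemma (in fin_digraph) long_apath_of_rainbow_colouring:
  assumes g: "girth G = enat g" "0 < g" and ne: "verts G \<noteq> {}" and k: "0 < k"
    and rainbow: "\<And>v i. v \<in> verts G \<Longrightarrow> i < k \<Longrightarrow> \<exists>e\<in>arcs G. tail G e = v \<and> f (head G e) = (i::nat)"
  shows "\<exists>u p v. apath u p v \<and> k * g \<le> Suc (length p)"
proof -
  have seg: "\<exists>q x. apath w q x \<and> (\<forall>y\<in>set (awalk_verts w q). f y = i) \<and> g \<le> Suc (length q)"
    if "i < k" "w \<in> verts G" "f w = i" for w i
    using long_apath_in_closed_set[OF g(1) that(2), of "{y. f y = i}"] rainbow that by fastforce
  \<comment> \<open>The colour bound keeps the path disjoint from the next segment, all of whose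
    vertices have colour \<open>Suc j\<close>. Lengths are counted in vertices, so that joining two
    segments by an arc adds the counts exactly.\<close>
  have "\<exists>u p v. apath u p v \<and> (\<forall>y\<in>set (awalk_verts u p). f y \<le> j) \<and> Suc j * g \<le> Suc (length p)"
    if "j < k" for j
    using that
  proof (induction j)
    case 0
    obtain v where "v \<in> verts G" using ne by blast
    then obtain e where e: "e \<in> arcs G" "f (head G e) = 0" using rainbow k by blast
    \<comment> \<open>The head of an arc out of an arbitrary vertex serves as a first vertex of
      colour 0.\<close>
    then show ?case using seg[OF 0, of "head G e"] by fastforce
  next
    case (Suc j)
    then obtain u p v where p: "apath u p v" "\<forall>y\<in>set (awalk_verts u p). f y \<le> j"
      "Suc j * g \<le> Suc (length p)" by auto
    have aw: "awalk u p v" using p by (simp add: apath_def)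
    have vl: "awlast u p = v" using aw by (rule awlast_of_awalk) simp
    obtain e where e: "e \<in> arcs G" "tail G e = v" "f (head G e) = Suc j"
      using rainbow[OF awalk_last_in_verts[OF aw] Suc.prems] by blast
    obtain q x where q: "apath (head G e) q x" "\<forall>y\<in>set (awalk_verts (head G e) q). f y = Suc j"
      "g \<le> Suc (length q)" using seg[OF Suc.prems _ e(3)] e(1) by auto
    have "v \<in> set (awalk_verts u p)" using vl last_in_set[OF awalk_verts_non_Nil] by metis
    then have "f v \<le> j" using p by blast
    then have "v \<notin> set (awalk_verts (head G e) q)" using q(2) by fastforce
    then have eq: "apath v (e # q) x" using e q by (simp add: apath_Cons_iff)
    have "set (awalk_verts u p) \<inter> set (awalk_verts (head G e) q) = {}"
      using p(2) q(2) by fastforce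
    then have "apath u (p @ e # q) x"
      using p(1) eq vl by (simp add: apath_append_iff)
    moreover have "set (awalk_verts u (p @ e # q))
        \<subseteq> set (awalk_verts u p) \<union> set (awalk_verts (head G e) q)"
      using awalk_verts_append[of u p "e # q" x] calculation vl by (auto simp: apath_def)
    then have "\<forall>y\<in>set (awalk_verts u (p @ e # q)). f y \<le> Suc j"
      using p(2) q(2) by fastforce
    moreover have "Suc (Suc j) * g \<le> Suc (length (p @ e # q))" using p(3) q(3) by simp
    ultimately show ?case by blast
  qed
  from this[of "k - 1"] k show ?thesis by auto
qed

section \<open>From regularity to a colouring, and the choice of constants\<close>

lemma (in digraph) Cd_regular_rainbow_colouring:
  assumes reg: "Cd_regular C d G" and C: "0 \<le> C" and d: "0 < d" and k: "0 < k"
    and small: "k = 1 \<or> 4 * (real k * exp (- real d / real k)) * (real d * (C * real d)) \<le> 1"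
  shows "\<exists>f. \<forall>v\<in>verts G. \<forall>i<k. \<exists>e\<in>arcs G. tail G e = v \<and> f (head G e) = i"
proof (cases "k = 1")
  case True
  \<comment> \<open>With a single colour, the constant colouring works as soon as every vertex has
    an out-arc.\<close>
  have "out_arcs G v \<noteq> {}" if "v \<in> verts G" for v
    using reg that d by (auto simp: Cd_regular_def out_degree_def)
  then show ?thesis using True by (intro exI[of _ "\<lambda>_. 0"]) (auto simp: out_arcs_def)
next
  case False
  \<comment> \<open>Out-degrees are bounded only from below, while the local lemma needs few
    dependencies, so each out-neighbourhood is trimmed to exactly \<open>d\<close> vertices. Without
    parallel arcs there are enough distinct heads.\<close>
  have "\<exists>M. M \<subseteq> head G ` out_arcs G v \<and> card M = d" if "v \<in> verts G" for v
  proof -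
    have "inj_on (head G) (out_arcs G v)"
      by (intro inj_onI no_multi_arcs) (auto simp: arc_to_ends_def)
    then have "d \<le> card (head G ` out_arcs G v)"
      using reg that by (simp add: card_image Cd_regular_def out_degree_def)
    then show ?thesis by (meson obtain_subset_with_card_n)
  qed
  then obtain N where N: "\<And>v. v \<in> verts G \<Longrightarrow> N v \<subseteq> head G ` out_arcs G v"
      "\<And>v. v \<in> verts G \<Longrightarrow> card (N v) = d"
    by metis
  have "\<exists>f. (\<forall>v\<in>verts G. f v < k) \<and> (\<forall>v\<in>verts G. \<forall>i<k. \<exists>u\<in>N v. f u = i)"
  proof (rule exists_rainbow_colouring)
    show "N v \<subseteq> verts G" if "v \<in> verts G" for v
      using N(1)[OF that] by (auto simp: out_arcs_def)
    show "real (card {v \<in> verts G. u \<in> N v}) \<le> C * real d" if "u \<in> verts G" for u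
    proof -
      have "{v \<in> verts G. u \<in> N v} \<subseteq> tail G ` in_arcs G u"
        using N(1) by (fastforce simp: out_arcs_def in_arcs_def)
      then have "card {v \<in> verts G. u \<in> N v} \<le> in_degree G u"
        unfolding in_degree_def by (meson card_image_le card_mono finite_imageI finite_in_arcs le_trans)
      then show ?thesis using reg that by (fastforce simp: Cd_regular_def)
    qed
  qed (use N(2) d k small False in auto)
  then obtain f where f: "\<forall>v\<in>verts G. \<forall>i<k. \<exists>u\<in>N v. f u = i" by blast
  have "\<exists>e\<in>arcs G. tail G e = v \<and> f (head G e) = i" if "v \<in> verts G" "i < k" for v i
    using f that N(1)[OF that(1)] by (fastforce simp: out_arcs_def)
  then show ?thesis by blast
qed

text \<open>With k at most d / (K ln d), exp(-d/k) is at most d^(-K). For K = m + 3, three powers of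
  d absorb \<open>k * d * d\<close>, and the remaining d^m is at least 2^m and absorbs
  \<open>4 * C\<close>. Rounding down to an integer costs the factor 2.\<close>

lemma exists_number_of_colours:
  fixes C :: real
  assumes d: "2 \<le> d" and C: "0 < C" and m: "4 * C \<le> 2 ^ m"
  shows "\<exists>k>0. (k = 1 \<or> 4 * (real k * exp (- real d / real k)) * (real d * (C * real d)) \<le> 1)
     \<and> real d / (real (m + 3) * ln (real d)) \<le> 2 * real k"
proof -
  define K where "K = m + 3"
  define t where "t = real d / (real K * ln (real d))"
  have ln: "0 < ln (real d)" using d by simp
  have K: "0 < K" by (simp add: K_def)
  have t0: "0 < t" using ln K d by (simp add: t_def)
  show ?thesis
  proof (cases "t < 2")
    case True
    then show ?thesis by (intro exI[of _ 1]) (auto simp: t_def K_def)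
  next
    case False
    define k where "k = nat \<lfloor>t\<rfloor>"
    have k: "real k \<le> t" "t < real k + 1" using t0 by (auto simp: k_def)
    then have k1: "1 \<le> k" using False by linarith
    have "real K * ln (real d) * real k \<le> real d"
      using k(1) ln K by (simp add: t_def field_simps)
    then have "real K * ln (real d) \<le> real d / real k"
      using k1 by (simp add: field_simps)
    then have "exp (real K * ln (real d)) \<le> exp (real d / real k)" by simp
    moreover have "exp (real K * ln (real d)) = real d ^ K" using d by (simp add: exp_of_nat_mult)
    ultimately have e: "real d ^ K * exp (- real d / real k) \<le> 1"
      by (simp add: exp_minus field_simps)
    \<comment> \<open>Since K is at least 3, this bound on ln 2 gives \<open>t \<le> d\<close>,
      hence \<open>k \<le> d\<close>.\<close>
    have "1 / 2 \<le> ln (2::real)" by (rule iffD2[OF ln_ge_iff exp_half_le2]) simp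
    also have "\<dots> \<le> ln (real d)" using d by simp
    finally have "1 \<le> real K * ln (real d)"
      using mult_mono[of 3 "real K" "1/2" "ln (real d)"] by (simp add: K_def)
    then have "t \<le> real d" using ln K d by (simp add: t_def divide_le_eq mult_le_cancel_left1)
    then have kd: "real k \<le> real d" using k by linarith
    have "4 * C \<le> real d ^ m"
      using m power_mono[of 2 "real d" m] d by simp
    then have "4 * C * (real k * real d * real d) \<le> real d ^ m * (real d * real d * real d)"
      using kd C by (intro mult_mono) auto
    then have "4 * C * (real k * real d * real d) \<le> real d ^ K"
      by (simp add: K_def power_add eval_nat_numeral mult_ac)
    then have "4 * C * (real k * real d * real d) * exp (- real d / real k)
        \<le> real d ^ K * exp (- real d / real k)" by (rule mult_right_mono) simp
    from order_trans[OF this e]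
    have "4 * (real k * exp (- real d / real k)) * (real d * (C * real d)) \<le> 1"
      by (simp add: mult_ac)
    moreover have "t \<le> 2 * real k" using k k1 by linarith
    ultimately show ?thesis using k1 by (intro exI[of _ k]) (auto simp: t_def K_def)
  qed
qed

theorem theorem3:
  fixes C :: real
  assumes "C > 0"
  shows "\<exists>c::real. c > 0 \<and>
    (\<forall>(d::nat) (g::nat) (D::('a, 'b) pre_digraph).
       d \<ge> 2 \<longrightarrow> digraph D \<longrightarrow> verts D \<noteq> {} \<longrightarrow> Cd_regular C d D \<longrightarrow> girth D = enat g \<longrightarrow>
       (\<exists>u p v. pre_digraph.apath D u p v \<and>
          real (length p) \<ge> c * real d * real g / ln (real d)))"
proof -
  obtain m where m: "4 * C \<le> 2 ^ m"
    using real_arch_pow[of 2 "4 * C"] by (auto intro: less_imp_le)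
  \<comment> \<open>The 4 is a factor 2 from rounding the number of colours times a factor 2 from
    replacing vertices by arcs.\<close>
  define c where "c = 1 / (4 * real (m + 3))"
  have "\<exists>u p v. pre_digraph.apath D u p v \<and> real (length p) \<ge> c * real d * real g / ln (real d)"
    if d: "d \<ge> 2" and "digraph D" and ne: "verts D \<noteq> {}" and reg: "Cd_regular C d D"
      and g: "girth D = enat g" for d g and D :: "('a, 'b) pre_digraph"
  proof -
    interpret digraph D by fact
    obtain k where k: "0 < k"
        "k = 1 \<or> 4 * (real k * exp (- real d / real k)) * (real d * (C * real d)) \<le> 1"
        "real d / (real (m + 3) * ln (real d)) \<le> 2 * real k"
      using exists_number_of_colours[OF d assms m] by (elim exE conjE) (rule that)
    have g2: "2 \<le> g" using girth_ge_2[OF g] .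
    obtain f where "\<forall>v\<in>verts D. \<forall>i<k. \<exists>e\<in>arcs D. tail D e = v \<and> f (head D e) = i"
      using Cd_regular_rainbow_colouring[OF reg _ _ k(1,2)] assms d by auto
    then obtain u p v where p: "apath u p v" "k * g \<le> Suc (length p)"
      using long_apath_of_rainbow_colouring[OF g _ ne k(1), of f] g2 by auto
    \<comment> \<open>This forces \<open>length p\<close> to be at least 1, so that
      \<open>Suc (length p)\<close> is at most \<open>2 * length p\<close>.\<close>
    have "2 \<le> k * g" using k(1) g2 mult_le_mono[of 1 k 2 g] by simp
    then have "k * g \<le> 2 * length p" using p(2) by linarith
    then have "real k * real g \<le> 2 * real (length p)"
      by (metis of_nat_le_iff of_nat_mult of_nat_numeral)
    moreover have "c * real d * real g / ln (real d)
        = real d / (real (m + 3) * ln (real d)) * real g / 4"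
      by (simp add: c_def)
    moreover have "\<dots> \<le> 2 * real k * real g / 4"
      using k(3) by (intro divide_right_mono mult_right_mono) auto
    ultimately have "c * real d * real g / ln (real d) \<le> real (length p)" by linarith
    then show ?thesis using p(1) by blast
  qed
  moreover have "c > 0" by (simp add: c_def)
  ultimately show ?thesis by blast
qed

end
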